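(* Let $\mathcal A$ be a class of Boolean functions and suppose there is a constant $K>0$ such that for every $f\in\mathcal A$ there is a splitting variable $x_m$ (where $m$ may depend on $f$) for which: (i) the split functions $f^{+}$ and $f^{-}$ belong to $\mathcal A$; (ii) ${\bf H}(f)-\frac12\big[{\bf H}(f^+)+{\bf H}(f^-)\big]\le K\,{\bf I}_m(f)$. Then the FEI conjecture holds for $\mathcal A$, that is, ${\bf H}(f)\le K\,{\bf I}(f)$ for every $f\in\mathcal A$.
   Context: $[n]=\{1,\dots,n\}$. $\mathcal B_n$ is the set of Boolean functions $f:\{-1,1\}^n\to\{-1,1\}$; a class of Boolean functions is a subset of $\bigcup_{n\ge0}\mathcal B_n$. For $S\subset[n]$, $\chi_S(x)=\prod_{i\in S}x_i$ and $\widehat f(S)=2^{-n}\sum_x f(x)\chi_S(x)$. Define ${\bf I}_m(f)=\sum_{S\ni m}\widehat f(S)^2$, ${\bf I}(f)=\sum_{S\subset[n]}|S|\widehat f(S)^2$, ${\bf H}(f)=\sum_{S\subset[n]}\widehat f(S)^2\log_2\frac1{\widehat f(S)^2}$ (with $0\log_2(1/0):=0$). Splitting $f\in\mathcal B_n$ ($n\ge1$) by $x_m$, $m\in[n]$, gives $f^{\pm}(x_1,\dots,x_{m-1},x_{m+1},\dots,x_n)=f(x_1,\dots,x_{m-1},\pm1,x_{m+1},\dots,x_n)$, regarded as elements of $\mathcal B_{n-1}$ (relabelling the remaining variables in increasing order). $\mathcal B_0$ consists of the two constants $\pm1$, for which ${\bf H}={\bf I}=0$; the hypothesis on the existence of a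 splitting variable is imposed on all $f\in\mathcal A\cap\mathcal B_n$ with $n\ge1$. *)

theory Defs
  imports Complex_Main
begin

(* Points of {-1,1}^n are functions on nat that vanish off {1..n}, and Boolean functions
   vanish off the cube. Filling up with 0, a value outside {-1,1}, instead of "undefined" makes the
   cubes, and the sets boolean_functions n, pairwise disjoint for different n. *)

definition cube :: "nat \<Rightarrow> (nat \<Rightarrow> real) set" where
  "cube n = {x. (\<forall>i\<in>{1..n}. x i \<in> {-1, 1}) \<and> (\<forall>i. i \<notin> {1..n} \<longrightarrow> x i = 0)}"

definition boolean_functions :: "nat \<Rightarrow> ((nat \<Rightarrow> real) \<Rightarrow> real) set" where
  "boolean_functions n = {f. (\<forall>x\<in>cube n. f x \<in> {-1, 1}) \<and> (\<forall>x. x \<notin> cube n \<longrightarrow> f x = 0)}"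

definition character :: "nat set \<Rightarrow> (nat \<Rightarrow> real) \<Rightarrow> real" where
  "character S x = (\<Prod>i\<in>S. x i)"

definition fourier_coeff :: "nat \<Rightarrow> ((nat \<Rightarrow> real) \<Rightarrow> real) \<Rightarrow> nat set \<Rightarrow> real" where
  "fourier_coeff n f S = (\<Sum>x\<in>cube n. f x * character S x) / 2 ^ n"

definition influence :: "nat \<Rightarrow> nat \<Rightarrow> ((nat \<Rightarrow> real) \<Rightarrow> real) \<Rightarrow> real" where
  "influence n m f = (\<Sum>S\<in>{S. S \<subseteq> {1..n} \<and> m \<in> S}. (fourier_coeff n f S)\<^sup>2)"

definition total_influence :: "nat \<Rightarrow> ((nat \<Rightarrow> real) \<Rightarrow> real) \<Rightarrow> real" where
  "total_influence n f = (\<Sum>S\<in>Pow {1..n}. real (card S) * (fourier_coeff n f S)\<^sup>2)"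

(* A vanishing coefficient contributes 0, because of the factor in front of the logarithm. *)
definition spectral_entropy :: "nat \<Rightarrow> ((nat \<Rightarrow> real) \<Rightarrow> real) \<Rightarrow> real" where
  "spectral_entropy n f =
     (\<Sum>S\<in>Pow {1..n}. (fourier_coeff n f S)\<^sup>2 * log 2 (1 / (fourier_coeff n f S)\<^sup>2))"

(* (x_1, ..., x_(n-1)) is sent to (x_1, ..., x_(m-1), s, x_m, ..., x_(n-1)). *)
definition insert_coord :: "nat \<Rightarrow> real \<Rightarrow> (nat \<Rightarrow> real) \<Rightarrow> nat \<Rightarrow> real" where
  "insert_coord m s x = (\<lambda>i. if i < m then x i else if i = m then s else x (i - 1))"

definition split_fun :: "nat \<Rightarrow> real \<Rightarrow> ((nat \<Rightarrow> real) \<Rightarrow> real) \<Rightarrow> (nat \<Rightarrow> real) \<Rightarrow> real" where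
  "split_fun m s f = (\<lambda>x. f (insert_coord m s x))"

lemma cube_nonempty: "cube n \<noteq> {}"
proof -
  have "(\<lambda>i. if i \<in> {1..n} then 1 else 0) \<in> cube n" by (auto simp: cube_def)
  then show ?thesis by blast
qed

lemma cube_dim_unique:
  assumes "x \<in> cube n" "x \<in> cube k"
  shows "n = k"
proof -
  have "{1..n} = {i. x i \<noteq> 0}" "{1..k} = {i. x i \<noteq> 0}"
    using assms by (force simp: cube_def)+
  then have "card {1..n} = card {1..k}" by simp
  then show ?thesis by simp
qed

lemma boolean_functions_dim_unique:
  assumes "f \<in> boolean_functions n" "f \<in> boolean_functions k"
  shows "n = k"
proof -
  obtain x where x: "x \<in> cube n" using cube_nonempty by blast
  then have "f x \<noteq> 0" using assms(1) by (force simp: boolean_functions_def)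
  then have "x \<in> cube k" using assms(2) by (auto simp: boolean_functions_def)
  with x show ?thesis by (rule cube_dim_unique)
qed

lemma insert_coord_in_cube_iff:
  assumes m: "m \<in> {1..n}" and s: "s \<in> {-1, 1}"
  shows "insert_coord m s x \<in> cube n \<longleftrightarrow> x \<in> cube (n - 1)"
proof
  assume y: "insert_coord m s x \<in> cube n"
  have below: "x i = insert_coord m s x i" if "i < m" for i
    using that by (simp add: insert_coord_def)
  have above: "x i = insert_coord m s x (Suc i)" if "\<not> i < m" for i
    using that by (simp add: insert_coord_def)
  have "x i \<in> {-1, 1}" if "i \<in> {1..n - 1}" for i
    using y m that below[of i] above[of i] by (cases "i < m") (auto simp: cube_def)
  moreover have "x i = 0" if "i \<notin> {1..n - 1}" for i
    using y m that below[of i] above[of i] by (cases "i < m") (auto simp: cube_def)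
  ultimately show "x \<in> cube (n - 1)" by (simp add: cube_def)
next
  assume x: "x \<in> cube (n - 1)"
  have "insert_coord m s x i \<in> {-1, 1}" if i: "i \<in> {1..n}" for i
  proof -
    consider "i < m" | "i = m" | "m < i" by linarith
    then show ?thesis
    proof cases
      case 1
      then have "i \<in> {1..n - 1}" using m i by auto
      with x 1 show ?thesis by (simp add: cube_def insert_coord_def)
    next
      case 2
      with s show ?thesis by (simp add: insert_coord_def)
    next
      case 3
      then have "i - 1 \<in> {1..n - 1}" using m i by auto
      then have "x (i - 1) \<in> {-1, 1}" using x unfolding cube_def by blast
      with 3 show ?thesis by (simp add: insert_coord_def)
    qed
  qed
  moreover have "insert_coord m s x i = 0" if i: "i \<notin> {1..n}" for i
  proof (cases "i = 0")
    case True
    with x m show ?thesis by (simp add: cube_def insert_coord_def)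
  next
    case False
    then have "m < i" "i - 1 \<notin> {1..n - 1}" using m i by auto
    moreover from this(2) have "x (i - 1) = 0" using x unfolding cube_def by blast
    ultimately show ?thesis by (simp add: insert_coord_def)
  qed
  ultimately show "insert_coord m s x \<in> cube n" by (simp add: cube_def)
qed

lemma split_fun_in_boolean_functions:
  assumes "f \<in> boolean_functions n" "m \<in> {1..n}" "s \<in> {-1, 1}"
  shows "split_fun m s f \<in> boolean_functions (n - 1)"
  using assms(1) insert_coord_in_cube_iff[OF assms(2,3)]
  by (simp add: boolean_functions_def split_fun_def)

end

theory Submission
  imports Defs
begin

text \<open>
  Multiplied by \<open>K\<close>, the total influence satisfies with equality the recursion that the hypothesis
  imposes as an inequality on the spectral entropy:
  \<open>I(f) = I\<^sub>m(f) + (I(f\<^sup>+) + I(f\<^sup>-)) / 2\<close> for every variable \<open>x\<^sub>m\<close>.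
  Hence the bound \<open>H \<le> K I\<close> passes from the two split functions, which have one variable less, to
  \<open>f\<close>, and it follows by induction on the number of variables; both sides vanish for the
  constants \<open>\<plusminus>1\<close> on the cube of dimension 0.

  The recursion comes from Fourier analysis. Each subset of the variables other than \<open>x\<^sub>m\<close>
  corresponds to a subset \<open>T\<close> of the \<open>n - 1\<close> renumbered variables. If \<open>a\<close> and \<open>b\<close> are the
  coefficients of \<open>f\<^sup>+\<close> and \<open>f\<^sup>-\<close> at \<open>T\<close>, then \<open>f\<close> has the coefficients \<open>(a + b) / 2\<close>
  at the set itself and \<open>(a - b) / 2\<close> at the set with \<open>m\<close> added (lemma
  \<open>fourier_coeff_split\<close>). Their squares add up to \<open>(a\<^sup>2 + b\<^sup>2) / 2\<close>; weighted by
  cardinality, the larger set contributes its squared coefficient once more, and these extra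
  terms make up \<open>I\<^sub>m(f)\<close> (lemma \<open>total_influence_split\<close>).
\<close>

section \<open>Splitting the cube and the Fourier coefficients\<close>

text \<open>
  The position in \<open>(x\<^sub>1, \<dots>, x\<^sub>n)\<close> of the \<open>i\<close>-th variable that remains after \<open>x\<^sub>m\<close>
  has been split off.
\<close>

definition skip :: "nat \<Rightarrow> nat \<Rightarrow> nat" where
  "skip m i = (if i < m then i else Suc i)"

lemma inj_skip: "inj (skip m)"
  by (auto simp: inj_def skip_def split: if_splits)

lemma skip_neq [simp]: "skip m i \<noteq> m" "m \<noteq> skip m i"
  by (auto simp: skip_def)

lemma notin_skip_image [simp]: "m \<notin> skip m ` T"
  by auto

lemma skip_image_atLeastAtMost:
  assumes "m \<in> {1..n}"
  shows "skip m ` {1..n - 1} = {1..n} - {m}"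
proof (intro equalityI subsetI)
  fix j assume "j \<in> skip m ` {1..n - 1}"
  then show "j \<in> {1..n} - {m}" using assms by (auto simp: skip_def)
next
  fix j assume j: "j \<in> {1..n} - {m}"
  show "j \<in> skip m ` {1..n - 1}"
  proof (cases "j < m")
    case True
    then have "j = skip m j" "j \<in> {1..n - 1}" using j assms by (auto simp: skip_def)
    then show ?thesis by blast
  next
    case False
    then have "j = skip m (j - 1)" "j - 1 \<in> {1..n - 1}" using j assms by (auto simp: skip_def)
    then show ?thesis by blast
  qed
qed

lemma insert_coord_at [simp]: "insert_coord m s x m = s"
  by (simp add: insert_coord_def)

lemma insert_coord_skip [simp]: "insert_coord m s x (skip m i) = x i"
  by (simp add: insert_coord_def skip_def)

lemma insert_coord_collapse: "insert_coord m (y m) (\<lambda>i. y (skip m i)) = y"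
  by (rule ext) (auto simp: insert_coord_def skip_def)

lemma bij_betw_insert_coord:
  assumes m: "m \<in> {1..n}"
  shows "bij_betw (\<lambda>(s, x). insert_coord m s x) ({1, -1} \<times> cube (n - 1)) (cube n)"
    (is "bij_betw ?h ?D _")
proof (rule bij_betw_imageI)
  show "inj_on ?h ?D"
  proof (rule inj_onI, clarify)
    fix s t x y assume eq: "insert_coord m s x = insert_coord m t y"
    have "x = y"
    proof
      fix i show "x i = y i" using fun_cong[OF eq, of "skip m i"] by simp
    qed
    moreover have "s = t" using fun_cong[OF eq, of m] by simp
    ultimately show "s = t \<and> x = y" by simp
  qed
  show "?h ` ?D = cube n"
  proof (intro equalityI subsetI)
    fix y assume "y \<in> ?h ` ?D"
    then show "y \<in> cube n" using insert_coord_in_cube_iff[OF m] by auto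
  next
    fix y assume y: "y \<in> cube n"
    let ?x = "\<lambda>i. y (skip m i)"
    have s: "y m \<in> {-1, 1}" using y m by (simp add: cube_def)
    then have "?x \<in> cube (n - 1)"
      using y insert_coord_in_cube_iff[OF m s, of ?x] by (simp add: insert_coord_collapse)
    with s have "(y m, ?x) \<in> ?D" by auto
    moreover have "y = ?h (y m, ?x)" by (simp add: insert_coord_collapse)
    ultimately show "y \<in> ?h ` ?D" by (rule rev_image_eqI)
  qed
qed

lemma sum_cube_split:
  fixes g :: "(nat \<Rightarrow> real) \<Rightarrow> real"
  assumes "m \<in> {1..n}"
  shows "(\<Sum>x\<in>cube n. g x) =
    (\<Sum>x\<in>cube (n - 1). g (insert_coord m 1 x)) + (\<Sum>x\<in>cube (n - 1). g (insert_coord m (-1) x))"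
proof -
  have "(\<Sum>x\<in>cube n. g x) = (\<Sum>(s, x)\<in>{1, -1} \<times> cube (n - 1). g (insert_coord m s x))"
    using sum.reindex_bij_betw[OF bij_betw_insert_coord[OF assms], of g]
    by (simp add: case_prod_unfold)
  also have "\<dots> = (\<Sum>s\<in>{1, -1}. \<Sum>x\<in>cube (n - 1). g (insert_coord m s x))"
    by (simp add: sum.cartesian_product)
  finally show ?thesis by simp
qed

lemma character_skip_image: "character (skip m ` T) (insert_coord m s x) = character T x"
  unfolding character_def
  by (simp add: prod.reindex[OF inj_on_subset[OF inj_skip subset_UNIV]])

lemma character_insert_skip_image:
  assumes "finite T"
  shows "character (insert m (skip m ` T)) (insert_coord m s x) = s * character T x"
  using assms character_skip_image[of m T s x] by (simp add: character_def)

text \<open>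
  The character of a set that avoids \<open>m\<close> does not depend on \<open>x\<^sub>m\<close>, while adding \<open>m\<close> to the set
  multiplies it by \<open>x\<^sub>m\<close>, which is \<open>\<plusminus>1\<close> on the two halves of the cube.
\<close>

lemma fourier_coeff_split:
  fixes f :: "(nat \<Rightarrow> real) \<Rightarrow> real"
  assumes m: "m \<in> {1..n}" and T: "finite T"
  defines "a \<equiv> fourier_coeff (n - 1) (split_fun m 1 f) T"
    and "b \<equiv> fourier_coeff (n - 1) (split_fun m (-1) f) T"
  shows "fourier_coeff n f (skip m ` T) = (a + b) / 2"
    and "fourier_coeff n f (insert m (skip m ` T)) = (a - b) / 2"
proof -
  have two: "(2::real) ^ n = 2 * 2 ^ (n - 1)"
    using m by (cases n) auto
  show "fourier_coeff n f (skip m ` T) = (a + b) / 2"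
    by (simp add: a_def b_def fourier_coeff_def sum_cube_split[OF m] character_skip_image
        split_fun_def two add_divide_distrib)
  show "fourier_coeff n f (insert m (skip m ` T)) = (a - b) / 2"
    by (simp add: a_def b_def fourier_coeff_def sum_cube_split[OF m] T
        character_insert_skip_image split_fun_def two diff_divide_distrib sum_negf)
qed

section \<open>Subsets of the variables and the total influence\<close>

lemma inj_on_insert_skip_image: "inj_on (\<lambda>T. insert m (skip m ` T)) X"
proof (rule inj_onI)
  fix T U assume "insert m (skip m ` T) = insert m (skip m ` U)"
  then have "skip m ` T = skip m ` U" by (simp add: insert_ident)
  then show "T = U" by (simp add: inj_image_eq_iff[OF inj_skip])
qed

lemma skip_image_Pow:
  assumes m: "m \<in> {1..n}"
  shows "(\<lambda>T. skip m ` T) ` Pow {1..n - 1} = Pow ({1..n} - {m})"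
  by (simp only: image_Pow_surj[OF skip_image_atLeastAtMost[OF m]])

lemma subsets_containing_eq:
  assumes m: "m \<in> {1..n}"
  shows "{S. S \<subseteq> {1..n} \<and> m \<in> S} = (\<lambda>T. insert m (skip m ` T)) ` Pow {1..n - 1}"
proof -
  have "{S. S \<subseteq> {1..n} \<and> m \<in> S} = insert m ` Pow ({1..n} - {m})"
  proof (intro equalityI subsetI)
    fix S assume "S \<in> {S. S \<subseteq> {1..n} \<and> m \<in> S}"
    then have "S = insert m (S - {m})" "S - {m} \<in> Pow ({1..n} - {m})" by auto
    then show "S \<in> insert m ` Pow ({1..n} - {m})" by blast
  qed (use m in auto)
  also have "\<dots> = (\<lambda>T. insert m (skip m ` T)) ` Pow {1..n - 1}"
    unfolding skip_image_Pow[OF m, symmetric] image_image ..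
  finally show ?thesis .
qed

lemma sum_subsets_containing:
  fixes g :: "nat set \<Rightarrow> real"
  assumes m: "m \<in> {1..n}"
  shows "sum g {S. S \<subseteq> {1..n} \<and> m \<in> S} = (\<Sum>T\<in>Pow {1..n - 1}. g (insert m (skip m ` T)))"
  unfolding subsets_containing_eq[OF m]
  by (simp add: sum.reindex[OF inj_on_insert_skip_image])

lemma sum_Pow_split:
  fixes g :: "nat set \<Rightarrow> real"
  assumes m: "m \<in> {1..n}"
  shows "sum g (Pow {1..n}) =
    (\<Sum>T\<in>Pow {1..n - 1}. g (skip m ` T)) + (\<Sum>T\<in>Pow {1..n - 1}. g (insert m (skip m ` T)))"
proof -
  have "Pow {1..n} = Pow ({1..n} - {m}) \<union> {S. S \<subseteq> {1..n} \<and> m \<in> S}" by blast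
  then have "sum g (Pow {1..n}) = sum g (Pow ({1..n} - {m})) + sum g {S. S \<subseteq> {1..n} \<and> m \<in> S}"
    by (simp only:) (rule sum.union_disjoint, auto)
  moreover have "inj_on (\<lambda>T. skip m ` T) (Pow {1..n - 1})"
    by (rule inj_onI) (simp add: inj_image_eq_iff[OF inj_skip])
  then have "sum g (Pow ({1..n} - {m})) = (\<Sum>T\<in>Pow {1..n - 1}. g (skip m ` T))"
    unfolding skip_image_Pow[OF m, symmetric] by (simp add: sum.reindex)
  ultimately show ?thesis by (simp only: sum_subsets_containing[OF m])
qed

text \<open>
  Here \<open>|insert m (skip m ` T)| = |T| + 1\<close>: the summand \<open>1\<close> yields the influence of \<open>x\<^sub>m\<close>, and the
  summand \<open>|T|\<close> is combined with the term of \<open>skip m ` T\<close> by the parallelogram law.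
\<close>

lemma total_influence_split:
  assumes m: "m \<in> {1..n}"
  shows "total_influence n f = influence n m f
    + (total_influence (n - 1) (split_fun m 1 f) + total_influence (n - 1) (split_fun m (-1) f)) / 2"
proof -
  let ?c = "fourier_coeff n f"
  let ?a = "fourier_coeff (n - 1) (split_fun m 1 f)"
  let ?b = "fourier_coeff (n - 1) (split_fun m (-1) f)"
  let ?P = "Pow {1..n - 1}"
  have level: "real (card (skip m ` T)) * (?c (skip m ` T))\<^sup>2
      + real (card (insert m (skip m ` T))) * (?c (insert m (skip m ` T)))\<^sup>2
      = (?c (insert m (skip m ` T)))\<^sup>2
        + (real (card T) * (?a T)\<^sup>2 + real (card T) * (?b T)\<^sup>2) / 2"
    if "T \<in> ?P" for T
  proof -
    have T: "finite T" using that finite_subset by auto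
    have card: "card (skip m ` T) = card T"
      by (rule card_image) (rule inj_on_subset[OF inj_skip subset_UNIV])
    have parallelogram: "((u + v) / 2)\<^sup>2 + ((u - v) / 2)\<^sup>2 = (u\<^sup>2 + v\<^sup>2) / 2" for u v :: real
      by (simp add: power2_eq_square field_simps)
    have "(?c (skip m ` T))\<^sup>2 + (?c (insert m (skip m ` T)))\<^sup>2 = ((?a T)\<^sup>2 + (?b T)\<^sup>2) / 2"
      unfolding fourier_coeff_split[OF m T] by (rule parallelogram)
    then have "real (card T) * ((?c (skip m ` T))\<^sup>2 + (?c (insert m (skip m ` T)))\<^sup>2)
        = (real (card T) * (?a T)\<^sup>2 + real (card T) * (?b T)\<^sup>2) / 2"
      by (simp add: distrib_left add_divide_distrib)
    then show ?thesis using T by (simp add: card algebra_simps)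
  qed
  have "total_influence n f
      = (\<Sum>T\<in>?P. real (card (skip m ` T)) * (?c (skip m ` T))\<^sup>2
          + real (card (insert m (skip m ` T))) * (?c (insert m (skip m ` T)))\<^sup>2)"
    unfolding total_influence_def sum_Pow_split[OF m] by (simp only: sum.distrib)
  also have "\<dots> = (\<Sum>T\<in>?P. (?c (insert m (skip m ` T)))\<^sup>2
        + (real (card T) * (?a T)\<^sup>2 + real (card T) * (?b T)\<^sup>2) / 2)"
    by (rule sum.cong[OF refl level])
  also have "\<dots> = influence n m f
    + (total_influence (n - 1) (split_fun m 1 f) + total_influence (n - 1) (split_fun m (-1) f)) / 2"
    unfolding total_influence_def influence_def sum_subsets_containing[OF m]
    by (simp only: sum.distrib sum_divide_distrib[symmetric])
  finally show ?thesis .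
qed

section \<open>Induction on the number of variables\<close>

text \<open>The only coefficient is the value \<open>\<plusminus>1\<close> of \<open>f\<close>, whose square has logarithm 0.\<close>

lemma spectral_entropy_0:
  assumes "f \<in> boolean_functions 0"
  shows "spectral_entropy 0 f = 0"
proof -
  have cube: "cube 0 = {\<lambda>_. 0}" by (auto simp: cube_def)
  have "fourier_coeff 0 f {} = f (\<lambda>_. 0)"
    by (simp add: fourier_coeff_def cube character_def)
  moreover have "f (\<lambda>_. 0) \<in> {-1, 1}"
    using assms by (simp add: boolean_functions_def cube)
  ultimately show ?thesis by (auto simp: spectral_entropy_def)
qed

theorem mainTheorem2:
  fixes A :: "((nat \<Rightarrow> real) \<Rightarrow> real) set" and K :: real
  assumes "A \<subseteq> (\<Union>n. boolean_functions n)"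
    and "K > 0"
    and "\<And>n f. n \<ge> 1 \<Longrightarrow> f \<in> A \<inter> boolean_functions n \<Longrightarrow>
      \<exists>m\<in>{1..n}.
        split_fun m 1 f \<in> A \<and> split_fun m (-1) f \<in> A \<and>
        spectral_entropy n f
          - (1 / 2) * (spectral_entropy (n - 1) (split_fun m 1 f)
                       + spectral_entropy (n - 1) (split_fun m (-1) f))
        \<le> K * influence n m f"
  shows "\<forall>n. \<forall>f \<in> A \<inter> boolean_functions n. spectral_entropy n f \<le> K * total_influence n f"
proof -
  have "spectral_entropy n f \<le> K * total_influence n f" if "f \<in> A" "f \<in> boolean_functions n" for n f
    using that
  proof (induction n arbitrary: f)
    case 0
    then show ?case by (simp add: spectral_entropy_0 total_influence_def)
  next
    case (Suc n)
    obtain m where m: "m \<in> {1..Suc n}"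
      and inA: "split_fun m 1 f \<in> A" "split_fun m (-1) f \<in> A"
      and step: "spectral_entropy (Suc n) f
        - (1 / 2) * (spectral_entropy n (split_fun m 1 f)
                     + spectral_entropy n (split_fun m (-1) f))
        \<le> K * influence (Suc n) m f"
      using assms(3)[of "Suc n" f] Suc.prems by auto
    let ?p = "split_fun m 1 f" and ?q = "split_fun m (-1) f"
    have "?p \<in> boolean_functions n" "?q \<in> boolean_functions n"
      using split_fun_in_boolean_functions[OF Suc.prems(2) m] by auto
    then have "spectral_entropy n ?p \<le> K * total_influence n ?p"
        "spectral_entropy n ?q \<le> K * total_influence n ?q"
      using Suc.IH inA by blast+
    moreover have "K * total_influence (Suc n) f = K * influence (Suc n) m f
        + (K * total_influence n ?p + K * total_influence n ?q) / 2"
      by (simp add: total_influence_split[OF m] algebra_simps)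
    ultimately show ?case using step by (simp add: field_simps)
  qed
  then show ?thesis by blast
qed

end
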